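(* Let $G=(V,E)$ be a finite (or infinite) graph with measure bound $\mu_{max}$ (that is, $\mu(x)\le\mu_{max}$ for all $x\in V$), and suppose that a function $f:V\times\mathbb R\to\mathbb R$ satisfies $$\frac{\Gamma(f)}{f^2}-\alpha(t)\frac{\partial_tf}{f}\le\psi(t)$$ whenever $x\in B(x_o,R)$ for $x_o\in V$ along with some $R>0$, and some functions $\alpha(t)\ge1$, $\psi$. Then for $T_1<T_2$ and $x,y\in V$, $$f(x,T_1)\le f(y,T_2)\exp\left(\int_{T_1}^{T_2}\frac{\psi(t)}{\alpha(t)}\,dt+\rho_{\mu_{max},\alpha,\omega_{min}}(x,y,T_1,T_2)\right),$$ where $$\rho_{\mu_{max},\alpha,\omega_{min}}(x,y,T_1,T_2)=\inf\left\{\sum_{i=0}^{k-1}\frac{4\mu_{max}k^3}{\omega_{min}(T_2-T_1)^3}\int_{t_i}^{t_{i+1}}ds\int_{t_i}^s\alpha(u)\,du\right\},$$ the infimum is taken over the set of all paths $P=p_0p_1\cdots p_k$ so that $p_0=x$, $p_k=y$ and having all $p_i\in B(x_o,R)$, and the times $T_1=t_0,t_1,\dots,t_k=T_2$ evenly divide the interval $[T_1,T_2]$.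
   Context: $G=(V,E)$ is a graph with positive edge weights $\omega_{xy}$ for $x\sim y$, $\mu$ is a positive measure on $V$, and $\deg(x)=\sum_{y\sim x}\omega_{xy}$. Standing assumptions: $\omega_{min}:=\inf_{e\in E}\omega_e>0$, $D_\omega:=\max_{x\sim y}\frac{\deg(x)}{\omega_{xy}}<\infty$, $D_\mu:=\max_{x\in V}\frac{\deg(x)}{\mu(x)}<\infty$. $B(x_o,R)$ is the ball of radius $R$ around $x_o$ in the graph distance; a path is a sequence of vertices in which consecutive vertices are adjacent. The gradient form is $\Gamma(f,g)(x)=\frac{1}{2\mu(x)}\sum_{y\sim x}\omega_{xy}(f(y)-f(x))(g(y)-g(x))$, and $\Gamma(f)=\Gamma(f,f)$; it acts on the space variable.
   Formalization: The function f is assumed positive on V×ℝ (the claim fails for f(x,t) = −e^t with ψ = 0) and differentiable in t on the ball; α and ψ/α are assumed integrable on [T_1,T_2] so that the integrals make sense. *)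

theory Defs
  imports "HOL-Analysis.Analysis"
begin

text \<open>The edge set is a symmetric relation on the vertex set; loops are allowed. The sums defining
  \<open>deg\<close> and \<open>gradient_form\<close> range over neighbourhoods, so these must be finite: otherwise \<open>sum\<close> would
  return 0. Finiteness of the weighted degree together with \<open>\<omega>\<^sub>m\<^sub>i\<^sub>n > 0\<close> forces this anyway.\<close>

definition deg :: "('v \<times> 'v) set \<Rightarrow> ('v \<Rightarrow> 'v \<Rightarrow> real) \<Rightarrow> 'v \<Rightarrow> real" where
  "deg E \<omega> x = (\<Sum>y\<in>E `` {x}. \<omega> x y)"

definition omega_min :: "('v \<times> 'v) set \<Rightarrow> ('v \<Rightarrow> 'v \<Rightarrow> real) \<Rightarrow> real" where
  "omega_min E \<omega> = (INF (x, y)\<in>E. \<omega> x y)"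

text \<open>For an edgeless graph \<open>omega_min\<close> is an unspecified real (the infimum is over the empty set),
  hence the guard \<open>E \<noteq> {}\<close>. The last two assumptions say that \<open>D\<^sub>\<omega>\<close> and \<open>D\<^sub>\<mu>\<close>, read as suprema,
  are finite.\<close>

locale weighted_graph =
  fixes V :: "'v set" and E :: "('v \<times> 'v) set"
    and \<omega> :: "'v \<Rightarrow> 'v \<Rightarrow> real" and \<mu> :: "'v \<Rightarrow> real"
  assumes edges: "E \<subseteq> V \<times> V"
    and edges_sym: "sym E"
    and locally_finite: "x \<in> V \<Longrightarrow> finite (E `` {x})"
    and weight_sym: "(x, y) \<in> E \<Longrightarrow> \<omega> x y = \<omega> y x"
    and weight_pos: "(x, y) \<in> E \<Longrightarrow> \<omega> x y > 0"
    and measure_pos: "x \<in> V \<Longrightarrow> \<mu> x > 0"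
    and omega_min_pos: "E \<noteq> {} \<Longrightarrow> omega_min E \<omega> > 0"
    and D_omega_finite: "bdd_above ((\<lambda>(x, y). deg E \<omega> x / \<omega> x y) ` E)"
    and D_mu_finite: "bdd_above ((\<lambda>x. deg E \<omega> x / \<mu> x) ` V)"

definition gradient_form :: "('v \<times> 'v) set \<Rightarrow> ('v \<Rightarrow> 'v \<Rightarrow> real) \<Rightarrow> ('v \<Rightarrow> real)
    \<Rightarrow> ('v \<Rightarrow> real) \<Rightarrow> ('v \<Rightarrow> real) \<Rightarrow> 'v \<Rightarrow> real" where
  "gradient_form E \<omega> \<mu> f g x =
     1 / (2 * \<mu> x) * (\<Sum>y\<in>E `` {x}. \<omega> x y * (f y - f x) * (g y - g x))"

text \<open>A path \<open>p\<^sub>0 \<dots> p\<^sub>k\<close> is a list of \<open>k + 1\<close> vertices, so that \<open>k = length p - 1\<close>.\<close>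

definition paths :: "'v set \<Rightarrow> ('v \<times> 'v) set \<Rightarrow> 'v \<Rightarrow> 'v \<Rightarrow> 'v list set" where
  "paths V E x y = {p. p \<noteq> [] \<and> set p \<subseteq> V \<and> successively (\<lambda>u v. (u, v) \<in> E) p
                       \<and> hd p = x \<and> last p = y}"

definition graph_dist :: "'v set \<Rightarrow> ('v \<times> 'v) set \<Rightarrow> 'v \<Rightarrow> 'v \<Rightarrow> enat" where
  "graph_dist V E x y = (INF p\<in>paths V E x y. enat (length p - 1))"

definition graph_ball :: "'v set \<Rightarrow> ('v \<times> 'v) set \<Rightarrow> 'v \<Rightarrow> real \<Rightarrow> 'v set" where
  "graph_ball V E x\<^sub>o R = {x \<in> V. ereal_of_enat (graph_dist V E x\<^sub>o x) \<le> ereal R}"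

definition time_pt :: "real \<Rightarrow> real \<Rightarrow> nat \<Rightarrow> nat \<Rightarrow> real" where
  "time_pt T1 T2 k i = T1 + real i * (T2 - T1) / real k"

text \<open>The infimum over paths inside \<open>B\<close>. It is taken in \<open>ereal\<close>, so it is \<open>\<infinity>\<close> if there is no
  such path. For \<open>x = y\<close> the one-vertex path (\<open>k = 0\<close>) is admitted and contributes the
  empty sum.\<close>

definition rho :: "'v set \<Rightarrow> ('v \<times> 'v) set \<Rightarrow> ('v \<Rightarrow> 'v \<Rightarrow> real) \<Rightarrow> 'v set \<Rightarrow> real
    \<Rightarrow> (real \<Rightarrow> real) \<Rightarrow> 'v \<Rightarrow> 'v \<Rightarrow> real \<Rightarrow> real \<Rightarrow> ereal" where
  "rho V E \<omega> B \<mu>max \<alpha> x y T1 T2 =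
     (INF p\<in>{p \<in> paths V E x y. set p \<subseteq> B}.
        let k = length p - 1; t = time_pt T1 T2 k in
        ereal (\<Sum>i<k. 4 * \<mu>max * real k ^ 3 / (omega_min E \<omega> * (T2 - T1) ^ 3)
                 * integral {t i..t (Suc i)} (\<lambda>s. integral {t i..s} \<alpha>)))"

definition exp_ereal :: "ereal \<Rightarrow> ereal" where
  "exp_ereal z = (if z = \<infinity> then \<infinity> else if z = -\<infinity> then 0 else ereal (exp (real_of_ereal z)))"

end

theory Submission
  imports Defs
begin

text \<open>Along an edge \<open>(p, q)\<close> of a path, traversed during \<open>[a, b]\<close>, interpolate
  \<open>\<Phi> = W ln f(q, \<cdot>) + (1 - W) ln f(p, \<cdot>)\<close> with a weight \<open>W\<close> rising smoothly from 0 to 1, so that the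
  increment of \<open>\<Phi>\<close> is \<open>ln f(q, b) - ln f(p, a)\<close>. The Li--Yau inequality at both \<open>p\<close> and \<open>q\<close> bounds
  the terms with time derivatives from below by \<open>(c (W (r - 1)\<^sup>2 + (1 - W) (1/r - 1)\<^sup>2) - \<psi>) / \<alpha>\<close>, where
  \<open>r = f(p, \<cdot>) / f(q, \<cdot>)\<close> and \<open>c = \<omega>\<^sub>m\<^sub>i\<^sub>n / (2 \<mu>\<^sub>m\<^sub>a\<^sub>x)\<close>. The remaining term
  \<open>- W' ln r\<close> is absorbed by Young's inequality at the cost \<open>2 (b - s) \<alpha>(s) / (c (b - a)\<^sup>3)\<close>, whose
  integral is the edge's contribution to \<open>\<rho>\<close>. Using the gradient at \<open>q\<close> alone would not
  give this constant for every \<open>\<alpha>\<close>.\<close>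

section \<open>Scalar inequalities for the smooth weight\<close>

text \<open>With \<open>h = ln r / 2\<close> this is
  \<open>\<bar>h\<bar> \<le> \<bar>sinh h\<bar>\<close>. The bound is invariant under replacing
  \<open>r\<close> by \<open>1 / r\<close>, so it serves the gradient terms at both ends of an
  edge.\<close>

lemma ln_power2_le:
  fixes r :: real
  assumes "0 < r"
  shows "(ln r)\<^sup>2 \<le> (r - 1)\<^sup>2 / r"
proof -
  define h where "h = ln r / 2"
  have "\<bar>h\<bar> \<le> \<bar>sinh h\<bar>"
    using real_le_abs_sinh[of h] by (simp add: sinh_field_def exp_minus)
  then have "h\<^sup>2 \<le> (sinh h)\<^sup>2"
    by (simp add: abs_le_square_iff)
  moreover have "(sinh h)\<^sup>2 = (r - 1)\<^sup>2 / (4 * r)"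
  proof -
    have r: "r = exp h ^ 2"
      using assms by (simp add: h_def flip: exp_double)
    show ?thesis
      unfolding r by (simp add: sinh_field_def exp_minus field_simps power2_eq_square)
  qed
  ultimately show ?thesis
    by (simp add: h_def field_simps)
qed

text \<open>Any \<open>W\<close> rising from 0 to 1 with \<open>W'\<^sup>2 \<le> 8 (1 - v) (W r + (1 - W) / r)\<close> for all \<open>r \<ge> 1\<close> would serve
  as a weight; \<open>W = v\<^sup>2 (3 - 2 v)\<close>, with \<open>W' = 6 v (1 - v)\<close>, satisfies this.\<close>

lemma smoothstep_bound:
  fixes v r :: real
  assumes "0 \<le> v" "v \<le> 1" "1 \<le> r"
  defines "W \<equiv> v\<^sup>2 * (3 - 2 * v)"
  shows "9 / 2 * v\<^sup>2 * (1 - v) \<le> W * r + (1 - W) / r"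
proof -
  let ?X = "W * r + (1 - W) / r"
  have W0: "0 \<le> W"
    using assms by simp
  have W1: "1 - W = (1 - v)\<^sup>2 * (1 + 2 * v)"
    by (simp add: W_def power2_eq_square algebra_simps)
  have W1': "0 \<le> 1 - W"
    unfolding W1 using assms by simp
  show ?thesis
  proof (cases "v \<le> 1 / 2")
    case True
    \<comment> \<open>AM-GM: \<open>?X\<close> is at least twice the square root of
      \<open>W * (1 - W)\<close>, hence at least \<open>3 * v * (1 - v)\<close>. The remaining
      factor \<open>3 / 2 * v\<close> is below 1 in this case.\<close>
    have "(3 * v * (1 - v))\<^sup>2 \<le> 4 * (W * (1 - W))"
    proof -
      have "3 * 3 \<le> 4 * ((3 - 2 * v) * (1 + 2 * v))"
        using mult_nonneg_nonneg[of v "1 - v"] assms by (simp add: algebra_simps)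
      then have "(v * (1 - v))\<^sup>2 * (3 * 3) \<le> (v * (1 - v))\<^sup>2 * (4 * ((3 - 2 * v) * (1 + 2 * v)))"
        by (rule mult_left_mono) simp
      then show ?thesis
        unfolding W1 unfolding W_def power2_eq_square by (simp only: mult_ac)
    qed
    also have "\<dots> \<le> ?X\<^sup>2"
    proof -
      have "?X\<^sup>2 - 4 * (W * (1 - W)) = (W * r - (1 - W) / r)\<^sup>2"
        using assms by (simp add: field_simps power2_eq_square)
      then show ?thesis
        by (smt (verit) zero_le_power2)
    qed
    finally have "3 * v * (1 - v) \<le> ?X"
      using W0 W1' assms by (intro power2_le_imp_le[of "3 * v * (1 - v)"]) auto
    moreover have "(3 / 2 * v) * (3 * v * (1 - v)) \<le> 1 * (3 * v * (1 - v))"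
      using True assms by (intro mult_right_mono) auto
    moreover have "9 / 2 * v\<^sup>2 * (1 - v) = (3 / 2 * v) * (3 * v * (1 - v))"
      by (simp add: power2_eq_square)
    ultimately show ?thesis
      by linarith
  next
    case False
    \<comment> \<open>Past the midpoint \<open>W \<ge> 1 / 2\<close>, so over
      \<open>r \<ge> 1\<close> the value of \<open>?X\<close> is smallest at \<open>r = 1\<close>,
      where it is 1.\<close>
    have "W - 1 / 2 = (v - 1 / 2) * (1 + 2 * (v * (1 - v)))"
      by (simp add: W_def power2_eq_square algebra_simps)
    also have "\<dots> \<ge> 0"
      using False assms by simp
    finally have "1 / 2 \<le> W"
      by simp
    have "?X - 1 = (r - 1) * (W * r - (1 - W)) / r"
      using assms by (simp add: field_simps)
    also have "\<dots> \<ge> 0"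
    proof -
      have "W * 1 \<le> W * r"
        using W0 assms by (intro mult_left_mono) auto
      then show ?thesis
        using \<open>1 / 2 \<le> W\<close> assms by (intro divide_nonneg_nonneg mult_nonneg_nonneg) auto
    qed
    finally have "1 \<le> ?X"
      by simp
    moreover have "9 / 2 * v\<^sup>2 * (1 - v) \<le> 1"
    proof -
      \<comment> \<open>The cubic peaks on the unit interval at \<open>v = 2 / 3\<close> with value
        \<open>2 / 3\<close>; hence the expansion about that point.\<close>
      have "1 - 9 / 2 * v\<^sup>2 * (1 - v) = 1 / 3 + (v - 2 / 3)\<^sup>2 * (9 / 2 * v + 3 / 2)"
        by (simp add: power2_eq_square field_simps)
      also have "\<dots> \<ge> 0"
        using assms by simp
      finally show ?thesis
        by simp
    qed
    ultimately show ?thesis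
      by linarith
  qed
qed

text \<open>The factor \<open>6 * v * (1 - v) / d\<close> is the time derivative of the weight over
  an interval of length \<open>d\<close>. It matters only for \<open>r > 1\<close>, where
  \<open>ln r\<close> is positive; there the two preceding bounds leave a quadratic in
  \<open>ln r\<close>.\<close>

lemma smoothstep_young:
  fixes v r A d :: real
  assumes v: "0 \<le> v" "v \<le> 1" and "0 < r" "0 < A" "0 < d"
  defines "W \<equiv> v\<^sup>2 * (3 - 2 * v)"
  shows "6 * v * (1 - v) / d * ln r
     \<le> A * (W * (r - 1)\<^sup>2 + (1 - W) * (1 / r - 1)\<^sup>2) + 2 * (1 - v) / (A * d\<^sup>2)"
proof (cases "r \<le> 1")
  case True
  have "1 - W = (1 - v)\<^sup>2 * (1 + 2 * v)"
    by (simp add: W_def power2_eq_square algebra_simps)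
  then have "0 \<le> W" "0 \<le> 1 - W"
    using v by (simp_all add: W_def)
  then have "0 \<le> A * (W * (r - 1)\<^sup>2 + (1 - W) * (1 / r - 1)\<^sup>2) + 2 * (1 - v) / (A * d\<^sup>2)"
    using assms by (intro add_nonneg_nonneg mult_nonneg_nonneg divide_nonneg_nonneg) auto
  moreover have "6 * v * (1 - v) / d * ln r \<le> 0"
    using assms True by (intro mult_nonneg_nonpos) auto
  ultimately show ?thesis
    by linarith
next
  case False
  define X where "X = W * r + (1 - W) / r"
  have X: "9 / 2 * v\<^sup>2 * (1 - v) \<le> X"
    unfolding X_def W_def using v False by (intro smoothstep_bound) auto
  have "0 \<le> 9 / 2 * v\<^sup>2 * (1 - v)"
    using v by simp
  with X have "0 \<le> X"
    by linarith
  have "W * (r - 1)\<^sup>2 + (1 - W) * (1 / r - 1)\<^sup>2 = X * ((r - 1)\<^sup>2 / r)"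
    using \<open>0 < r\<close> by (simp add: X_def field_simps power2_eq_square)
  also have "\<dots> \<ge> 9 / 2 * v\<^sup>2 * (1 - v) * (ln r)\<^sup>2"
    using X \<open>0 \<le> X\<close> ln_power2_le[OF \<open>0 < r\<close>] by (intro mult_mono) auto
  finally have "A * (9 / 2 * v\<^sup>2 * (1 - v) * (ln r)\<^sup>2)
      \<le> A * (W * (r - 1)\<^sup>2 + (1 - W) * (1 / r - 1)\<^sup>2)"
    using \<open>0 < A\<close> by simp
  \<comment> \<open>Young's inequality as a completed square: the coefficient
    \<open>9 / 2 * v\<^sup>2 * (1 - v)\<close> is \<open>W'\<^sup>2 / (8 * (1 - v))\<close> for
    \<open>W' = 6 * v * (1 - v)\<close>, exactly what makes the square perfect.\<close>
  moreover have "A * (9 / 2 * v\<^sup>2 * (1 - v) * (ln r)\<^sup>2) + 2 * (1 - v) / (A * d\<^sup>2)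
      - 6 * v * (1 - v) / d * ln r = (1 - v) / (2 * A) * (3 * v * A * ln r - 2 / d)\<^sup>2"
    using assms by (simp add: field_simps power2_eq_square)
  moreover have "\<dots> \<ge> 0"
    using assms by simp
  ultimately show ?thesis
    by linarith
qed

section \<open>Integration over one edge\<close>

text \<open>Since \<open>\<alpha>\<close> is only integrable, integration by parts needs an argument: \<open>F t = \<integral>\<^sub>a\<^sup>t (t - u) \<alpha>(u) du\<close> is
  still differentiable everywhere, because its difference quotients lie between values of the continuous
  indefinite integral \<open>I\<close> of \<open>\<alpha>\<close>.\<close>

lemma has_integral_iterated:
  fixes \<alpha> :: "real \<Rightarrow> real"
  assumes "a \<le> b" and int: "\<alpha> integrable_on {a..b}" and nonneg: "\<And>t. t \<in> {a..b} \<Longrightarrow> 0 \<le> \<alpha> t"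
  shows "((\<lambda>s. (b - s) * \<alpha> s) has_integral integral {a..b} (\<lambda>s. integral {a..s} \<alpha>)) {a..b}"
proof -
  define I where "I = (\<lambda>t. integral {a..t} \<alpha>)"
  define J where "J = (\<lambda>t. integral {a..t} (\<lambda>u. u * \<alpha> u))"
  define F where "F = (\<lambda>t. t * I t - J t)"
  have int': "(\<lambda>u. u * \<alpha> u) integrable_on {a..b}"
    \<comment> \<open>The second mean value theorem also yields integrability of the product with a
      monotone factor.\<close>
    using second_mean_value_theorem_full[OF int \<open>a \<le> b\<close>, of "\<lambda>u. u"] by (metis has_integral_integrable)
  have incr: "s * (I t - I s) \<le> J t - J s" "J t - J s \<le> t * (I t - I s)" "0 \<le> I t - I s"
    if "a \<le> s" "s \<le> t" "t \<le> b" for s t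
  proof -
    have sub: "{a..t} \<subseteq> {a..b}" "{s..t} \<subseteq> {a..b}"
      using that by auto
    note ints = integrable_subinterval_real[OF int sub(1)] integrable_subinterval_real[OF int sub(2)]
      integrable_subinterval_real[OF int' sub(1)] integrable_subinterval_real[OF int' sub(2)]
    have eq: "I t - I s = integral {s..t} \<alpha>" "J t - J s = integral {s..t} (\<lambda>u. u * \<alpha> u)"
      using Henstock_Kurzweil_Integration.integral_combine[OF that(1,2) ints(1)]
        Henstock_Kurzweil_Integration.integral_combine[OF that(1,2) ints(3)]
      by (simp_all add: I_def J_def)
    show "s * (I t - I s) \<le> J t - J s" "J t - J s \<le> t * (I t - I s)" "0 \<le> I t - I s"
      unfolding eq integral_mult_right[symmetric]
      using ints nonneg that
      by (auto intro!: integral_le integral_nonneg mult_right_mono integrable_on_mult_right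
          simp del: integral_mult_right)
  qed
  have est: "\<bar>(F y - F t) / (y - t) - I t\<bar> \<le> \<bar>I y - I t\<bar>"
    if "t \<in> {a..b}" "y \<in> {a..b}" "y \<noteq> t" for t y
  proof -
    \<comment> \<open>The left-hand expression is \<open>y * (I y - I t) - (J y - J t)\<close>,
      which \<open>incr\<close> places between 0 and \<open>(y - t) * (I y - I t)\<close>.\<close>
    have "\<bar>F y - F t - (y - t) * I t\<bar> \<le> \<bar>I y - I t\<bar> * \<bar>y - t\<bar>"
    proof (cases "t \<le> y")
      case True
      with incr[of t y] that show ?thesis
        by (simp add: F_def algebra_simps)
    next
      case False
      with incr[of y t] that show ?thesis
        by (simp add: F_def algebra_simps)
    qed
    moreover have "(F y - F t) / (y - t) - I t = (F y - F t - (y - t) * I t) / (y - t)"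
      using that by (simp add: field_simps)
    ultimately show ?thesis
      using that by (simp add: abs_divide divide_le_eq)
  qed
  have "(F has_vector_derivative I t) (at t within {a..b})" if t: "t \<in> {a..b}" for t
  proof -
    have "continuous_on {a..b} I"
      unfolding I_def using int by (rule indefinite_integral_continuous_1)
    then have "(I \<longlongrightarrow> I t) (at t within {a..b})"
      using t by (simp add: continuous_on_def)
    then have lim: "((\<lambda>y. \<bar>I y - I t\<bar>) \<longlongrightarrow> 0) (at t within {a..b})"
      using LIM_zero tendsto_rabs_zero by blast
    have "((\<lambda>y. (F y - F t) / (y - t) - I t) \<longlongrightarrow> 0) (at t within {a..b})"
      using est[OF t] by (intro Lim_null_comparison[OF _ lim]) (auto simp: eventually_at_filter)
    then show ?thesis
      by (simp add: has_field_derivative_iff LIM_zero_iff flip: has_real_derivative_iff_has_vector_derivative)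
  qed
  then have "(I has_integral (F b - F a)) {a..b}"
    by (rule fundamental_theorem_of_calculus[OF \<open>a \<le> b\<close>])
  moreover have "((\<lambda>s. b * \<alpha> s - s * \<alpha> s) has_integral (b * I b - J b)) {a..b}"
    unfolding I_def J_def using int int'
    by (intro has_integral_diff has_integral_mult_right integrable_integral)
  moreover have "F a = 0"
    by (simp add: F_def I_def J_def)
  ultimately show ?thesis
    by (simp add: F_def integral_unique left_diff_distrib flip: I_def)
qed


text \<open>\<open>F\<close> and \<open>G\<close> stand for \<open>f\<close> at the start and the
  end of the edge. A pointwise lower bound on \<open>\<Phi>'\<close> is integrated; the gauge
  integral makes \<open>\<Phi>'\<close> integrable from differentiability alone.\<close>

lemma ln_diff_le_on_edge:
  fixes F G \<alpha> \<psi> :: "real \<Rightarrow> real"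
  assumes "a < b" "0 < c"
    and pos: "\<And>t. t \<in> {a..b} \<Longrightarrow> 0 < F t" "\<And>t. t \<in> {a..b} \<Longrightarrow> 0 < G t"
    and deriv: "\<And>t. t \<in> {a..b} \<Longrightarrow> (F has_real_derivative F' t) (at t)"
      "\<And>t. t \<in> {a..b} \<Longrightarrow> (G has_real_derivative G' t) (at t)"
    and \<alpha>: "\<And>t. t \<in> {a..b} \<Longrightarrow> 0 < \<alpha> t"
    and ineq: "\<And>t. t \<in> {a..b} \<Longrightarrow> c * (G t / F t - 1)\<^sup>2 - \<alpha> t * (F' t / F t) \<le> \<psi> t"
      "\<And>t. t \<in> {a..b} \<Longrightarrow> c * (F t / G t - 1)\<^sup>2 - \<alpha> t * (G' t / G t) \<le> \<psi> t"
    and int: "\<alpha> integrable_on {a..b}" "(\<lambda>t. \<psi> t / \<alpha> t) integrable_on {a..b}"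
  shows "ln (F a) - ln (G b) \<le> integral {a..b} (\<lambda>t. \<psi> t / \<alpha> t)
    + 2 / (c * (b - a) ^ 3) * integral {a..b} (\<lambda>s. integral {a..s} \<alpha>)"
proof -
  define d where "d = b - a"
  have "0 < d"
    using assms by (simp add: d_def)
  define v where "v s = (s - a) / d" for s
  define W where "W s = (v s)\<^sup>2 * (3 - 2 * v s)" for s
  define \<Phi> where "\<Phi> s = W s * ln (G s) + (1 - W s) * ln (F s)" for s
  define \<Phi>' where "\<Phi>' s = 6 * v s * (1 - v s) / d * (ln (G s) - ln (F s))
      + W s * (G' s / G s) + (1 - W s) * (F' s / F s)" for s
  define K where "K = 2 / (c * d ^ 3)"
  have "(v has_real_derivative 1 / d) (at s)" for s
    unfolding v_def using \<open>0 < d\<close> by (auto intro!: derivative_eq_intros)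
  then have W': "(W has_real_derivative 6 * v s * (1 - v s) / d) (at s)" for s
    unfolding W_def
    by (auto intro!: derivative_eq_intros) (use \<open>0 < d\<close> in \<open>simp add: field_simps power2_eq_square\<close>)
  have "(\<Phi> has_real_derivative \<Phi>' s) (at s)" if "s \<in> {a..b}" for s
    unfolding \<Phi>_def \<Phi>'_def using pos[OF that]
    by (auto intro!: derivative_eq_intros W' deriv[OF that]
        simp: algebra_simps add_divide_distrib diff_divide_distrib)
  then have "(\<Phi>' has_integral (\<Phi> b - \<Phi> a)) {a..b}"
    using \<open>a < b\<close>
    by (intro fundamental_theorem_of_calculus)
      (auto simp: has_real_derivative_iff_has_vector_derivative intro: has_vector_derivative_at_within)
  moreover have "\<Phi> a = ln (F a)" "\<Phi> b = ln (G b)"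
    using \<open>0 < d\<close> by (simp_all add: \<Phi>_def W_def v_def flip: d_def)
  ultimately have 1: "(\<Phi>' has_integral (ln (G b) - ln (F a))) {a..b}"
    by simp
  have 2: "((\<lambda>s. - (\<psi> s / \<alpha> s) - K * ((b - s) * \<alpha> s)) has_integral
      (- integral {a..b} (\<lambda>t. \<psi> t / \<alpha> t) - K * integral {a..b} (\<lambda>s. integral {a..s} \<alpha>))) {a..b}"
    using assms
    by (intro has_integral_diff has_integral_neg has_integral_mult_right has_integral_iterated
        integrable_integral) (auto intro: less_imp_le)
  have "- (\<psi> s / \<alpha> s) - K * ((b - s) * \<alpha> s) \<le> \<Phi>' s" if s: "s \<in> {a..b}" for s
  proof -
    let ?P = "(F s / G s - 1)\<^sup>2" and ?Q = "(G s / F s - 1)\<^sup>2"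
    note pos = pos[OF s] and \<alpha> = \<alpha>[OF s]
    have v: "0 \<le> v s" "v s \<le> 1"
      using s \<open>0 < d\<close> by (auto simp: v_def d_def)
    have "1 - W s = (1 - v s)\<^sup>2 * (1 + 2 * v s)"
      by (simp add: W_def power2_eq_square algebra_simps)
    then have W: "0 \<le> W s" "0 \<le> 1 - W s"
      using v by (simp_all add: W_def)
    \<comment> \<open>Both Li-Yau inequalities get divided by \<open>\<alpha> s\<close>, so the
      quadratic coefficient is \<open>A = c / \<alpha> s\<close>.\<close>
    have "6 * v s * (1 - v s) / d * ln (F s / G s)
        \<le> c / \<alpha> s * (W s * ?P + (1 - W s) * ?Q) + 2 * (1 - v s) / (c / \<alpha> s * d\<^sup>2)"
      using smoothstep_young[OF v, of "F s / G s" "c / \<alpha> s" d] pos \<alpha> \<open>0 < c\<close> \<open>0 < d\<close>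
      by (simp add: W_def)
    moreover have "2 * (1 - v s) / (c / \<alpha> s * d\<^sup>2) = K * ((b - s) * \<alpha> s)"
    proof -
      have eq: "b - s = d * (1 - v s)"
      proof -
        have "d * v s = s - a"
          using \<open>0 < d\<close> by (simp add: v_def)
        then show ?thesis
          by (simp add: right_diff_distrib) (simp add: d_def)
      qed
      show ?thesis
        unfolding eq using \<alpha> \<open>0 < c\<close> \<open>0 < d\<close> by (simp add: K_def field_simps power2_eq_square power3_eq_cube)
    qed
    moreover have "W s * (c / \<alpha> s * ?P - \<psi> s / \<alpha> s) \<le> W s * (G' s / G s)"
      using ineq(2)[OF s] \<alpha> W by (intro mult_left_mono) (simp_all add: field_simps)
    moreover have "(1 - W s) * (c / \<alpha> s * ?Q - \<psi> s / \<alpha> s) \<le> (1 - W s) * (F' s / F s)"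
      using ineq(1)[OF s] \<alpha> W by (intro mult_left_mono) (simp_all add: field_simps)
    ultimately show ?thesis
      using pos by (simp add: \<Phi>'_def ln_div algebra_simps add_divide_distrib diff_divide_distrib)
  qed
  then have "- integral {a..b} (\<lambda>t. \<psi> t / \<alpha> t) - K * integral {a..b} (\<lambda>s. integral {a..s} \<alpha>)
      \<le> ln (G b) - ln (F a)"
    by (rule has_integral_le[OF 2 1])
  then show ?thesis
    by (simp add: K_def d_def)
qed

section \<open>Lower bounds for the gradient form\<close>

context weighted_graph
begin

lemma gradient_summand_nonneg:
  fixes g :: "'v \<Rightarrow> real"
  assumes "(z, w) \<in> E"
  shows "0 \<le> \<omega> z w * (g w - g z) * (g w - g z)"
  using weight_pos[OF assms] by (simp add: mult.assoc)

lemma gradient_form_nonneg: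
  assumes "z \<in> V"
  shows "0 \<le> gradient_form E \<omega> \<mu> g g z"
  unfolding gradient_form_def using measure_pos[OF assms] gradient_summand_nonneg
  by (intro mult_nonneg_nonneg[OF _ sum_nonneg]) auto

lemma omega_min_le:
  assumes "(z, w) \<in> E"
  shows "omega_min E \<omega> \<le> \<omega> z w"
proof -
  have "bdd_below ((\<lambda>(x, y). \<omega> x y) ` E)"
    by (rule bdd_belowI[of _ 0]) (auto intro: less_imp_le weight_pos)
  from cINF_lower[OF this assms] show ?thesis
    by (simp add: omega_min_def)
qed

text \<open>All summands are nonnegative, so only the one for the neighbour \<open>w\<close> is
  kept.\<close>

lemma gradient_form_ge:
  assumes "(z, w) \<in> E" "\<mu> z \<le> M"
  shows "omega_min E \<omega> / (2 * M) * (g w - g z)\<^sup>2 \<le> gradient_form E \<omega> \<mu> g g z"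
proof -
  have z: "z \<in> V" and "0 < \<mu> z"
    using assms edges measure_pos by auto
  have "omega_min E \<omega> / (2 * M) * (g w - g z)\<^sup>2 \<le> \<omega> z w / (2 * \<mu> z) * (g w - g z)\<^sup>2"
    using assms \<open>0 < \<mu> z\<close> omega_min_le[OF assms(1)] weight_pos[OF assms(1)]
    by (intro mult_right_mono frac_le) auto
  also have "\<dots> = 1 / (2 * \<mu> z) * (\<omega> z w * (g w - g z) * (g w - g z))"
    by (simp add: power2_eq_square)
  also have "\<dots> \<le> gradient_form E \<omega> \<mu> g g z"
    unfolding gradient_form_def using assms(1) \<open>0 < \<mu> z\<close> locally_finite[OF z] gradient_summand_nonneg
    by (intro mult_left_mono member_le_sum[of w _ "\<lambda>y. \<omega> z y * (g y - g z) * (g y - g z)"]) auto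
  finally show ?thesis .
qed

end

section \<open>Even time steps and summation along a path\<close>

text \<open>Keeping \<open>n\<close> apart from \<open>k\<close> lets the induction run over a fixed
  subdivision.\<close>

lemma integral_time_pt_sum:
  fixes g :: "real \<Rightarrow> real"
  assumes "T1 \<le> T2" "g integrable_on {T1..T2}" "n \<le> k" "0 < k"
  shows "(\<Sum>i<n. integral {time_pt T1 T2 k i..time_pt T1 T2 k (Suc i)} g)
    = integral {T1..time_pt T1 T2 k n} g"
  using \<open>n \<le> k\<close>
proof (induction n)
  case 0
  then show ?case
    by (simp add: time_pt_def)
next
  case (Suc n)
  have "time_pt T1 T2 k (Suc n) \<le> time_pt T1 T2 k k"
    using Suc.prems assms unfolding time_pt_def by (intro add_left_mono divide_right_mono mult_right_mono) auto
  also have "\<dots> = T2"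
    using assms by (simp add: time_pt_def)
  finally have "time_pt T1 T2 k (Suc n) \<le> T2" .
  moreover have "T1 \<le> time_pt T1 T2 k n" "time_pt T1 T2 k n \<le> time_pt T1 T2 k (Suc n)"
    using assms unfolding time_pt_def by (auto intro!: divide_right_mono mult_right_mono)
  ultimately show ?case
    using Suc assms
    by (simp add: Henstock_Kurzweil_Integration.integral_combine integrable_subinterval_real)
qed

theorem theorem5p2:
  fixes V :: "'v set" and E :: "('v \<times> 'v) set"
    and \<omega> :: "'v \<Rightarrow> 'v \<Rightarrow> real" and \<mu> :: "'v \<Rightarrow> real"
    and f :: "'v \<Rightarrow> real \<Rightarrow> real" and \<alpha> \<psi> :: "real \<Rightarrow> real"
    and \<mu>max R T1 T2 :: real and x\<^sub>o x y :: 'v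
  assumes "weighted_graph V E \<omega> \<mu>"
    and "\<And>z. z \<in> V \<Longrightarrow> \<mu> z \<le> \<mu>max"
    and "x\<^sub>o \<in> V" and "R > 0"
    and "\<And>z t. z \<in> V \<Longrightarrow> f z t > 0"
    and "\<And>z t. z \<in> graph_ball V E x\<^sub>o R \<Longrightarrow> (f z) differentiable (at t)"
    and "\<And>t. \<alpha> t \<ge> 1"
    and "\<And>z t. z \<in> graph_ball V E x\<^sub>o R \<Longrightarrow>
           gradient_form E \<omega> \<mu> (\<lambda>w. f w t) (\<lambda>w. f w t) z / (f z t)^2
             - \<alpha> t * (deriv (f z) t / f z t) \<le> \<psi> t"
    and "T1 < T2" and "x \<in> V" and "y \<in> V"
    and "\<alpha> integrable_on {T1..T2}"
    and "(\<lambda>t. \<psi> t / \<alpha> t) integrable_on {T1..T2}"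
  shows "ereal (f x T1) \<le> ereal (f y T2) *
           exp_ereal (ereal (integral {T1..T2} (\<lambda>t. \<psi> t / \<alpha> t))
             + rho V E \<omega> (graph_ball V E x\<^sub>o R) \<mu>max \<alpha> x y T1 T2)"
proof -
  interpret weighted_graph V E \<omega> \<mu>
    by fact
  let ?B = "graph_ball V E x\<^sub>o R"
  let ?\<rho> = "rho V E \<omega> ?B \<mu>max \<alpha> x y T1 T2"
  note \<mu>max = assms(2) and f_pos = assms(5) and li_yau = assms(8)
  have B: "z \<in> V" if "z \<in> ?B" for z
    using that by (simp add: graph_ball_def)
  have f_deriv: "(f z has_real_derivative deriv (f z) t) (at t)" if "z \<in> ?B" for z t
    using assms(6)[OF that] by (metis DERIV_imp_deriv real_differentiable_def)
  have \<alpha>: "0 < \<alpha> t" for t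
    using assms(7)[of t] by simp
  have "0 < \<mu>max"
    using measure_pos[OF \<open>x \<in> V\<close>] \<mu>max[OF \<open>x \<in> V\<close>] by simp
  define c where "c = omega_min E \<omega> / (2 * \<mu>max)"
  \<comment> \<open>After taking logarithms the claim reads \<open>L \<le> ?\<rho>\<close>; as
    \<open>?\<rho>\<close> is an infimum, it suffices to bound \<open>L\<close> by the cost of each
    path.\<close>
  define L where "L = ln (f x T1) - ln (f y T2) - integral {T1..T2} (\<lambda>t. \<psi> t / \<alpha> t)"
  have edge: "c * (f w t / f z t - 1)\<^sup>2 - \<alpha> t * (deriv (f z) t / f z t) \<le> \<psi> t"
    if "(z, w) \<in> E" "z \<in> ?B" for z w t
  proof -
    have "0 < f z t"
      using that f_pos B by simp
    then have "c * (f w t / f z t - 1)\<^sup>2 = c * (f w t - f z t)\<^sup>2 / (f z t)\<^sup>2"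
      by (simp add: field_simps)
    also have "\<dots> \<le> gradient_form E \<omega> \<mu> (\<lambda>w. f w t) (\<lambda>w. f w t) z / (f z t)\<^sup>2"
      unfolding c_def using gradient_form_ge[OF that(1) \<mu>max, of "\<lambda>w. f w t"] that B
      by (intro divide_right_mono) auto
    finally show ?thesis
      using li_yau[OF that(2), of t] by simp
  qed
  have path: "ereal L \<le> (let k = length p - 1; t = time_pt T1 T2 k in
      ereal (\<Sum>i<k. 4 * \<mu>max * real k ^ 3 / (omega_min E \<omega> * (T2 - T1) ^ 3)
        * integral {t i..t (Suc i)} (\<lambda>s. integral {t i..s} \<alpha>)))"
    if "p \<in> paths V E x y" "set p \<subseteq> ?B" for p
  proof -
    define k where "k = length p - 1"
    define t where "t = time_pt T1 T2 k"
    define S where "S i = 4 * \<mu>max * real k ^ 3 / (omega_min E \<omega> * (T2 - T1) ^ 3)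
        * integral {t i..t (Suc i)} (\<lambda>s. integral {t i..s} \<alpha>)" for i
    have p: "p \<noteq> []" "p ! 0 = x" "p ! k = y" "successively (\<lambda>u v. (u, v) \<in> E) p"
      using that by (auto simp: paths_def k_def hd_conv_nth last_conv_nth)
    have pB: "p ! i \<in> ?B" if "i \<le> k" for i
    proof -
      have "i < length p"
        using that p(1) by (cases p) (auto simp: k_def)
      then show ?thesis
        using \<open>set p \<subseteq> ?B\<close> nth_mem by blast
    qed
    have "L \<le> (\<Sum>i<k. S i)"
    proof (cases "k = 0")
      \<comment> \<open>The one-vertex path has empty cost, so \<open>L \<le> 0\<close> is required.
        Nonnegativity of the gradient form bounds the derivative of \<open>ln (f x s)\<close> below
        by \<open>- (\<psi> s / \<alpha> s)\<close>.\<close>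
      case True
      then have "x = y" "x \<in> ?B"
        using p pB[of 0] by auto
      have lower: "- (\<psi> s / \<alpha> s) \<le> deriv (f x) s / f x s" for s
      proof -
        have "0 \<le> gradient_form E \<omega> \<mu> (\<lambda>w. f w s) (\<lambda>w. f w s) x / (f x s)\<^sup>2"
          using gradient_form_nonneg[OF \<open>x \<in> V\<close>] by simp
        then have "- \<psi> s \<le> \<alpha> s * (deriv (f x) s / f x s)"
          using li_yau[OF \<open>x \<in> ?B\<close>, of s] by linarith
        then show ?thesis
          using \<alpha>[of s] by (simp add: field_simps)
      qed
      have "((\<lambda>s. ln (f x s)) has_real_derivative deriv (f x) s / f x s) (at s)" for s
        using f_pos[OF \<open>x \<in> V\<close>, of s]
        by (auto intro!: derivative_eq_intros f_deriv[OF \<open>x \<in> ?B\<close>])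
      then have "((\<lambda>s. deriv (f x) s / f x s) has_integral (ln (f x T2) - ln (f x T1))) {T1..T2}"
        using \<open>T1 < T2\<close>
        by (intro fundamental_theorem_of_calculus)
          (auto simp: has_real_derivative_iff_has_vector_derivative intro: has_vector_derivative_at_within)
      then have "- integral {T1..T2} (\<lambda>t. \<psi> t / \<alpha> t) \<le> ln (f x T2) - ln (f x T1)"
        using lower assms by (intro has_integral_le[OF has_integral_neg[OF integrable_integral]])
      then show ?thesis
        using True \<open>x = y\<close> by (simp add: L_def)
    next
      case False
      then have "0 < k"
        by simp
      have t0: "t 0 = T1" and tk: "t k = T2" and step: "t (Suc i) - t i = (T2 - T1) / k" for i
        using \<open>0 < k\<close> by (simp_all add: t_def time_pt_def field_simps)
      define u where "u i = ln (f (p ! i) (t i))" for i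
      have "u i - u (Suc i) \<le> integral {t i..t (Suc i)} (\<lambda>t. \<psi> t / \<alpha> t) + S i" if "i < k" for i
      proof -
        have e: "(p ! i, p ! Suc i) \<in> E"
          using successively_nth[OF p(4)] that by (simp add: k_def)
        \<comment> \<open>Both orientations are kept, since Li-Yau is applied at either end of the
          edge.\<close>
        note e = e symD[OF edges_sym e]
        have b: "p ! i \<in> ?B" "p ! Suc i \<in> ?B"
          using pB that by auto
        have "0 < c"
          unfolding c_def using omega_min_pos e \<open>0 < \<mu>max\<close>
          by (intro divide_pos_pos) auto
        have "0 < t (Suc i) - t i"
          unfolding step using \<open>T1 < T2\<close> \<open>0 < k\<close> by (intro divide_pos_pos) auto
        then have "t i < t (Suc i)"
          by simp
        have mono: "t m \<le> t n" if "m \<le> n" for m n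
          using that \<open>T1 < T2\<close> unfolding t_def time_pt_def
          by (intro add_left_mono divide_right_mono mult_right_mono) auto
        have sub: "{t i..t (Suc i)} \<subseteq> {T1..T2}"
          using mono[of 0 i] mono[of "Suc i" k] that by (auto simp: t0 tk)
        have "u i - u (Suc i) \<le> integral {t i..t (Suc i)} (\<lambda>t. \<psi> t / \<alpha> t)
            + 2 / (c * (t (Suc i) - t i) ^ 3) * integral {t i..t (Suc i)} (\<lambda>s. integral {t i..s} \<alpha>)"
          unfolding u_def
          using \<open>t i < t (Suc i)\<close> \<open>0 < c\<close> f_pos B b f_deriv \<alpha> e edge
            integrable_subinterval_real[OF assms(12) sub] integrable_subinterval_real[OF assms(13) sub]
          by (intro ln_diff_le_on_edge) auto
        \<comment> \<open>The step length \<open>(T2 - T1) / k\<close> gives the factor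
          \<open>k ^ 3\<close>, and \<open>c\<close> contributes
          \<open>2 * \<mu>max\<close>.\<close>
        moreover have "2 / (c * (t (Suc i) - t i) ^ 3)
            = 4 * \<mu>max * real k ^ 3 / (omega_min E \<omega> * (T2 - T1) ^ 3)"
          by (simp add: step c_def power_divide)
        ultimately show ?thesis
          by (simp add: S_def)
      qed
      then have "(\<Sum>i<k. u i - u (Suc i))
          \<le> (\<Sum>i<k. integral {t i..t (Suc i)} (\<lambda>t. \<psi> t / \<alpha> t) + S i)"
        by (intro sum_mono) auto
      also have "\<dots> = integral {T1..T2} (\<lambda>t. \<psi> t / \<alpha> t) + (\<Sum>i<k. S i)"
        using integral_time_pt_sum[OF _ assms(13), of k k] \<open>0 < k\<close> \<open>T1 < T2\<close> tk
        by (simp add: sum.distrib t_def)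
      finally show ?thesis
        unfolding sum_lessThan_telescope' by (simp add: L_def u_def p t0 tk)
    qed
    then show ?thesis
      by (simp add: Let_def S_def t_def k_def)
  qed
  then have L: "ereal L \<le> ?\<rho>"
    unfolding rho_def by (intro INF_greatest) auto
  note pos = f_pos[OF \<open>x \<in> V\<close>, of T1] f_pos[OF \<open>y \<in> V\<close>, of T2]
  show ?thesis
  proof (cases ?\<rho>)
    case (real r)
    then have "ln (f x T1) \<le> ln (f y T2) + (integral {T1..T2} (\<lambda>t. \<psi> t / \<alpha> t) + r)"
      using L by (simp add: L_def)
    then have "exp (ln (f x T1)) \<le> exp (ln (f y T2) + (integral {T1..T2} (\<lambda>t. \<psi> t / \<alpha> t) + r))"
      by simp
    then show ?thesis
      using pos by (simp add: real exp_ereal_def exp_add)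
  next
    \<comment> \<open>This covers the absence of a path inside the ball; the right-hand side is then
      infinite because \<open>f y T2 > 0\<close>.\<close>
    case PInf
    then show ?thesis
      using pos by (simp add: exp_ereal_def)
  next
    case MInf
    then show ?thesis
      using L by simp
  qed
qed

end
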